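(* Let $K_{n,n}$ be the complete bipartite graph with both parts of size $n$. Then $\chi_g^\infty(K_{n,n}) \geq 4$ when $n \geq 3$.
   Context: The eternal vertex coloring game (A-game) on a finite undirected graph $G$ with color set $\{1,\ldots,k\}$: all vertices are initially uncolored. Alice and Bob strictly alternate turns, Alice moving first overall. On a turn the player chooses one vertex. If it is uncolored, the player must give it a color not currently used on any of its neighbors; if it currently has color $c$, the player must change its color to a color different from $c$ that is not currently used on any of its neighbors. The player whose turn it is picks the vertex and the new color. Play proceeds in rounds: every vertex must be chosen $t$ times before any vertex is chosen $t+1$ times, for every integer $t\ge 1$ (so each vertex is chosen exactly once per round; turns keep alternating across rounds, so if $|V(G)|$ is odd Bob moves first in even-numbered rounds). If some player chooses a vertex $v$ (still available in the current round) that cannot be legally colored, i.e. every color in the color set other than the current color of $v$ (if any) appears on a neighbor of $v$, then Bob wins. In particular Bob may deliberately choose such a vertex. Alice wins if this never happens (the game goes on forever). The eternal game chromatic number $\chi_g^\infty(G)$ is the minimum $k$ such that Alice has a winning strategy on $G$ with $k$ colors. *)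

theory Defs
  imports "Graph_Theory.Kuratowski"
begin

text \<open>
  The eternal vertex colouring game, with Alice moving first. Graphs are the symmetric
  loop-free finite digraphs of the locale \<^locale>\<open>graph\<close>. A move is a pair of a vertex and a
  colour, and a history lists the moves made so far with the most recent move first. Hence
  \<^term>\<open>map_of h v\<close> is the current colour of \<open>v\<close> (\<open>None\<close> if \<open>v\<close> is still uncoloured), and Alice
  is to move exactly when the length of the history is even; turns alternate across rounds.
\<close>

type_synonym 'a history = "('a \<times> nat) list"

definition legal_colours :: "('a, 'b) pre_digraph \<Rightarrow> nat \<Rightarrow> 'a history \<Rightarrow> 'a \<Rightarrow> nat set" where
  "legal_colours G k h v =
     {c \<in> {1..k}. map_of h v \<noteq> Some c \<and> (\<forall>w. v \<rightarrow>\<^bsub>G\<^esub> w \<longrightarrow> map_of h w \<noteq> Some c)}"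

definition times_chosen :: "'a history \<Rightarrow> 'a \<Rightarrow> nat" where
  "times_chosen h v = count_list (map fst h) v"

text \<open>
  Rounds: \<open>v\<close> may be chosen for the \<open>(t + 1)\<close>-st time only if every vertex has already been
  chosen at least \<open>t\<close> times.
\<close>

definition available :: "('a, 'b) pre_digraph \<Rightarrow> 'a history \<Rightarrow> 'a \<Rightarrow> bool" where
  "available G h v \<longleftrightarrow>
     v \<in> verts G \<and> (\<forall>w \<in> verts G. times_chosen h v \<le> times_chosen h w)"

text \<open>
  Choosing an available vertex without a legal colour is permitted (and loses the game for
  Alice, whoever does it); the colour component of such a move carries no meaning.
\<close>

definition permitted :: "('a, 'b) pre_digraph \<Rightarrow> nat \<Rightarrow> 'a history \<Rightarrow> 'a \<times> nat \<Rightarrow> bool" where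
  "permitted G k h m \<longleftrightarrow>
     available G h (fst m) \<and>
     (legal_colours G k h (fst m) \<noteq> {} \<longrightarrow> snd m \<in> legal_colours G k h (fst m))"

text \<open>
  It suffices to inspect the most recent move, as a play stops as soon as Bob has won.
\<close>

fun bob_has_won :: "('a, 'b) pre_digraph \<Rightarrow> nat \<Rightarrow> 'a history \<Rightarrow> bool" where
  "bob_has_won G k [] \<longleftrightarrow> False"
| "bob_has_won G k (m # h) \<longleftrightarrow> legal_colours G k h (fst m) = {}"

text \<open>The histories that can arise when Alice plays the strategy \<open>\<sigma>\<close>:\<close>

inductive arises :: "('a, 'b) pre_digraph \<Rightarrow> nat \<Rightarrow> ('a history \<Rightarrow> 'a \<times> nat) \<Rightarrow> 'a history \<Rightarrow> bool"
  for G k \<sigma> where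
  start: "arises G k \<sigma> []"
| alice: "\<lbrakk>arises G k \<sigma> h; \<not> bob_has_won G k h; even (length h); permitted G k h (\<sigma> h)\<rbrakk>
    \<Longrightarrow> arises G k \<sigma> (\<sigma> h # h)"
| bob: "\<lbrakk>arises G k \<sigma> h; \<not> bob_has_won G k h; odd (length h); permitted G k h m\<rbrakk>
    \<Longrightarrow> arises G k \<sigma> (m # h)"

definition winning_strategy ::
    "('a, 'b) pre_digraph \<Rightarrow> nat \<Rightarrow> ('a history \<Rightarrow> 'a \<times> nat) \<Rightarrow> bool" where
  "winning_strategy G k \<sigma> \<longleftrightarrow>
     (\<forall>h. arises G k \<sigma> h \<longrightarrow>
        \<not> bob_has_won G k h \<and> (even (length h) \<longrightarrow> permitted G k h (\<sigma> h)))"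

text \<open>
  On a finite graph with at least one vertex the minimum exists: with two colours more than the
  maximum degree, every vertex always has a legal colour.
\<close>

definition eternal_game_chromatic_number :: "('a, 'b) pre_digraph \<Rightarrow> nat" where
  "eternal_game_chromatic_number G = (LEAST k. \<exists>\<sigma>. winning_strategy G k \<sigma>)"

end

theory Submission
  imports Defs
begin

text \<open>
  With at most three colours Bob wins on \<open>K\<^bsub>n,n\<^esub>\<close> by answering Alice's first move in the same part
  \<open>U\<close> with a second colour. If nobody gets stuck in the first round, the other part \<open>V\<close> ends up
  entirely in the third colour \<open>c\<close>, and \<open>U\<close> uses exactly the other two. As the number of vertices
  is even, Alice opens the second round. A vertex of \<open>V\<close> is stuck as long as \<open>U\<close> shows two colours,
  so she must make \<open>U\<close> monochromatic, of colour \<open>d\<close> say, by recolouring a vertex of \<open>U\<close>. Bob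
  recolours a vertex of \<open>V\<close> with the colour \<open>e\<close> that \<open>U\<close> has lost. Now the vertices of \<open>U\<close> are
  stuck, and Alice cannot repair this in one move, since at least two vertices of \<open>V\<close> still have
  colour \<open>c\<close>.
\<close>

section \<open>Rounds, and colour counts with which Alice wins\<close>

lemma times_chosen_Nil [simp]: "times_chosen [] v = 0"
  by (simp add: times_chosen_def)

lemma times_chosen_Cons [simp]:
  "times_chosen (m # h) v = (if fst m = v then Suc (times_chosen h v) else times_chosen h v)"
  by (simp add: times_chosen_def)

lemma times_chosen_eq_0_iff: "times_chosen h v = 0 \<longleftrightarrow> v \<notin> fst ` set h"
  by (simp add: times_chosen_def count_list_0_iff)

lemma times_chosen_distinct:
  assumes "distinct (map fst h)" "v \<in> fst ` set h"
  shows "times_chosen h v = 1"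
  using assms by (induction h) (auto simp: times_chosen_eq_0_iff)

lemma exists_available:
  assumes "finite (verts G)" "verts G \<noteq> {}"
  shows "\<exists>v. available G h v"
proof -
  obtain v where "v \<in> verts G" "\<forall>w \<in> verts G. times_chosen h v \<le> times_chosen h w"
    using assms arg_min_if_finite[of "verts G" "times_chosen h"] by (metis not_le)
  then show ?thesis by (auto simp: available_def)
qed

text \<open>The vertices of \<open>G\<close> together with \<open>v\<close> show at most
  \<open>card (verts G) + 1\<close> colours, so one of the \<open>k\<close> colours is left
  over.\<close>

lemma legal_colours_nonempty:
  assumes "wf_digraph G" "finite (verts G)" "card (verts G) + 2 \<le> k"
  shows "legal_colours G k h v \<noteq> {}"
proof -
  \<comment> \<open>An uncoloured vertex contributes the value \<open>the None\<close>, which at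
    worst rules out one colour too many; it is covered by the count.\<close>
  let ?S = "(\<lambda>w. the (map_of h w)) ` insert v (verts G)"
  have "card ?S \<le> card (insert v (verts G))"
    using assms by (intro card_image_le) auto
  also have "\<dots> < card {1..k}"
    using assms by (simp add: card_insert_if)
  finally have "\<not> {1..k} \<subseteq> ?S"
    using assms(2) by (meson card_mono finite.insertI finite_imageI not_le)
  then obtain c where c: "c \<in> {1..k}" "c \<notin> ?S" by blast
  have "map_of h w \<noteq> Some c" if "w \<in> insert v (verts G)" for w
    using c that by (metis imageI option.sel)
  then have "c \<in> legal_colours G k h v"
    using c(1) wf_digraph.adj_in_verts[OF assms(1)] by (auto simp: legal_colours_def)
  then show ?thesis by blast
qed

text \<open>Ensures that the \<open>LEAST\<close> in the definition of the eternal game chromatic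
  number is attained.\<close>

lemma winning_strategy_exists:
  assumes "wf_digraph G" "finite (verts G)" "verts G \<noteq> {}"
  shows "\<exists>k \<sigma>. winning_strategy G k \<sigma>"
proof -
  let ?k = "card (verts G) + 2"
  have legal: "legal_colours G ?k h v \<noteq> {}" for h v
    using assms by (intro legal_colours_nonempty) auto
  have "\<exists>m. permitted G ?k h m" for h
    using exists_available[OF assms(2,3), of h] legal[of h] by (fastforce simp: permitted_def)
  then obtain \<sigma> where \<sigma>: "permitted G ?k h (\<sigma> h)" for h by metis
  have "\<not> bob_has_won G ?k h" for h
    using legal by (cases h) auto
  with \<sigma> have "winning_strategy G ?k \<sigma>" by (simp add: winning_strategy_def)
  then show ?thesis by blast
qed

section \<open>Play against a supposed winning strategy\<close>

text \<open>The situation to be refuted. Its assumptions are symmetric in \<open>U\<close> and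
  \<open>V\<close>, so every lemma can also be used with the parts exchanged.\<close>

locale bipartite_win =
  fixes G :: "('a, 'b) pre_digraph" and k n :: nat and \<sigma> and U V :: "'a set"
  assumes n: "3 \<le> n" and k: "k \<le> 3"
    and verts: "verts G = U \<union> V" and disjoint: "U \<inter> V = {}"
    and card_U: "card U = n" and card_V: "card V = n"
    and arcs: "arcs_ends G = U \<times> V \<union> V \<times> U"
    and win: "winning_strategy G k \<sigma>"
begin

lemma swap: "bipartite_win G k n \<sigma> V U"
  using n k verts disjoint card_U card_V arcs win by unfold_locales auto

lemma finite_U: "finite U" and finite_V: "finite V"
  using card_U card_V n by (auto intro: card_ge_0_finite)

lemma finite_verts: "finite (verts G)" and verts_nonempty: "verts G \<noteq> {}"
  and card_verts: "card (verts G) = 2 * n"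
  using verts disjoint card_U card_V n finite_U finite_V by (auto simp: card_Un_disjoint)

text \<open>Since \<open>\<sigma>\<close> wins, no stuck vertex was ever chosen, so every move made
  carries a legal colour.\<close>

lemma arises_ConsD:
  assumes "arises G k \<sigma> (m # h)"
  shows "arises G k \<sigma> h" "available G h (fst m)" "snd m \<in> legal_colours G k h (fst m)"
proof -
  have "legal_colours G k h (fst m) \<noteq> {}"
    using assms win by (fastforce simp: winning_strategy_def)
  moreover from assms have "arises G k \<sigma> h \<and> permitted G k h m" by cases auto
  ultimately show "arises G k \<sigma> h" "available G h (fst m)" "snd m \<in> legal_colours G k h (fst m)"
    by (auto simp: permitted_def)
qed

lemma alice_move:
  assumes "arises G k \<sigma> h" "even (length h)"
  shows "arises G k \<sigma> (\<sigma> h # h)"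
  using assms win by (auto simp: winning_strategy_def intro: arises.alice)

lemma bob_move:
  assumes "arises G k \<sigma> h" "odd (length h)" "available G h v" "c \<in> legal_colours G k h v"
  shows "arises G k \<sigma> ((v, c) # h)"
  using assms win by (auto simp: winning_strategy_def permitted_def intro: arises.bob)

text \<open>Bob could choose a stuck vertex and win at once. The colour 0 of that move is
  arbitrary.\<close>

lemma bob_not_stuck:
  assumes "arises G k \<sigma> h" "odd (length h)" "available G h v"
  shows "legal_colours G k h v \<noteq> {}"
proof
  assume stuck: "legal_colours G k h v = {}"
  have "arises G k \<sigma> ((v, 0) # h)"
    using assms stuck win by (intro arises.bob) (auto simp: winning_strategy_def permitted_def)
  then show False using arises_ConsD(3) stuck by fastforce
qed

lemma map_of_colour:
  assumes "arises G k \<sigma> h" "map_of h v = Some c"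
  shows "c \<in> {1..k}"
  using assms
proof (induction h rule: list.induct)
  case (Cons m h)
  show ?case
    using Cons.IH Cons.prems(2) arises_ConsD[OF Cons.prems(1)]
    by (cases m) (auto simp: legal_colours_def split: if_splits)
qed simp

lemma proper:
  assumes "arises G k \<sigma> h" "x \<in> U" "y \<in> V" "map_of h x = Some c"
  shows "map_of h y \<noteq> Some c"
  using assms
proof (induction h rule: list.induct)
  case (Cons m h)
  have "x \<noteq> y" using Cons.prems disjoint by blast
  then show ?case
    using Cons arises_ConsD[OF Cons.prems(1)] arcs
    by (cases m) (auto simp: legal_colours_def split: if_splits)
qed simp

text \<open>The neighbours block \<open>a\<close> and \<open>b\<close>, and \<open>v\<close> may not
  keep \<open>c\<close>, so the palette is exhausted.\<close>

lemma stuck: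
  assumes "{1..k} \<subseteq> {a, b, c}" "v \<in> V" "x \<in> U" "y \<in> U"
    "map_of h x = Some a" "map_of h y = Some b" "map_of h v = Some c"
  shows "legal_colours G k h v = {}"
  using assms arcs by (auto simp: legal_colours_def)

section \<open>Playing out the first round\<close>

text \<open>With fewer moves than vertices some vertex is unchosen, so the minimal count is
  0.\<close>

lemma first_round_available:
  assumes "distinct (map fst h)" "length h < 2 * n" "available G h v"
  shows "v \<notin> fst ` set h"
proof -
  have "card (fst ` set h) < card (verts G)"
    using assms(2) card_verts card_image_le[of "set h" fst] card_length[of h] by simp
  then obtain w where "w \<in> verts G" "w \<notin> fst ` set h"
    by (metis List.finite_set card_mono finite_imageI not_le subsetI)
  then show ?thesis
    using assms(3) by (metis available_def le_zero_eq times_chosen_eq_0_iff)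
qed

text \<open>Induction on the number of moves left; Bob may play anything legal. Each move goes to a
  fresh vertex, so the colours already placed survive to the end of the round.\<close>

lemma complete_first_round:
  assumes "arises G k \<sigma> h" "distinct (map fst h)" "fst ` set h \<subseteq> verts G" "length h \<le> 2 * n"
  shows "\<exists>h'. arises G k \<sigma> h' \<and> distinct (map fst h') \<and> fst ` set h' \<subseteq> verts G \<and>
    length h' = 2 * n \<and> map_of h \<subseteq>\<^sub>m map_of h'"
  using assms
proof (induction "2 * n - length h" arbitrary: h)
  case 0
  then show ?case by (intro exI[of _ h]) auto
next
  case (Suc d)
  obtain m where m: "arises G k \<sigma> (m # h)"
  proof (cases "even (length h)")
    case True
    then show ?thesis using alice_move Suc.prems that by blast
  next
    case False
    obtain v where "available G h v"
      using exists_available finite_verts verts_nonempty by blast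
    with False show ?thesis using bob_not_stuck bob_move Suc.prems that by blast
  qed
  have avail: "available G h (fst m)" using arises_ConsD[OF m] by blast
  have fresh: "fst m \<notin> fst ` set h"
    using first_round_available[OF _ _ avail] Suc.prems Suc.hyps(2) by simp
  have "\<exists>h'. arises G k \<sigma> h' \<and> distinct (map fst h') \<and> fst ` set h' \<subseteq> verts G \<and>
    length h' = 2 * n \<and> map_of (m # h) \<subseteq>\<^sub>m map_of h'"
    using Suc.hyps Suc.prems m avail fresh by (intro Suc.hyps(1)) (auto simp: available_def)
  moreover have "map_of h \<subseteq>\<^sub>m map_of (m # h)"
    using fresh by (cases m) (auto simp: map_le_def dom_map_of_conv_image_fst)
  ultimately show ?case using map_le_trans by blast
qed

section \<open>The second round\<close>

lemma second_round_lost: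
  assumes ar: "arises G k \<sigma> h" and even: "even (length h)"
    and once: "\<And>v. v \<in> verts G \<Longrightarrow> times_chosen h v = 1"
    and kabc: "{1..k} = {a, b, c}" and ab: "a \<noteq> b"
    and p: "p \<in> U" "map_of h p = Some a" and q: "q \<in> U" "map_of h q = Some b"
    and V: "\<And>v. v \<in> V \<Longrightarrow> map_of h v = Some c"
    and U: "\<And>u. u \<in> U \<Longrightarrow> map_of h u = Some a \<or> map_of h u = Some b"
  shows False
proof -
  interpret swapped: bipartite_win G k n \<sigma> V U by (rule swap)
  obtain x d where m: "\<sigma> h = (x, d)" by fastforce
  define h1 where "h1 = (x, d) # h"
  have ar1: "arises G k \<sigma> h1" and odd1: "odd (length h1)"
    using alice_move[OF ar even] even by (simp_all add: h1_def m)
  note move1 = arises_ConsD(2,3)[OF ar1[unfolded h1_def], simplified]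
  have "x \<notin> V"
    using stuck[OF equalityD1[OF kabc] _ p(1) q(1) p(2) q(2) V] move1(2) by blast
  with move1(1) have x: "x \<in> U" by (auto simp: available_def verts)
  have avail1: "available G h1 v" if "v \<in> verts G" "v \<noteq> x" for v
    using that once by (auto simp: available_def h1_def)
  have V1: "map_of h1 v = Some c" if "v \<in> V" for v
    using that V x disjoint by (auto simp: h1_def)
  obtain v where v: "v \<in> V" using card_V n by fastforce
  have vx: "v \<noteq> x" using v x disjoint by blast
  \<comment> \<open>Otherwise Bob would choose \<open>v\<close>, still of colour \<open>c\<close>
    and stuck between \<open>a\<close> and \<open>b\<close>.\<close>
  have mono1: "\<not> (map_of h1 y = Some a \<and> map_of h1 z = Some b)" if "y \<in> U" "z \<in> U" for y z
  proof
    assume "map_of h1 y = Some a \<and> map_of h1 z = Some b"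
    then have "legal_colours G k h1 v = {}"
      using stuck[OF equalityD1[OF kabc] v that _ _ V1[OF v]] by simp
    then show False using bob_not_stuck[OF ar1 odd1 avail1[OF _ vx]] v verts by simp
  qed
  have xd: "map_of h1 x = Some d" by (simp add: h1_def)
  have dc: "d \<noteq> c" using proper[OF ar1 x v xd] V1[OF v] by blast
  have "d \<in> {a, b}" using map_of_colour[OF ar1 xd] kabc dc by blast
  then obtain e where e: "d = a \<and> e = b \<or> d = b \<and> e = a" by blast
  have U1: "map_of h1 u = Some d" if "u \<in> U" for u
  proof -
    have "map_of h1 u = Some d \<or> map_of h1 u = Some e"
      using U[OF that] e by (auto simp: h1_def)
    then show ?thesis
      using mono1[OF x that] mono1[OF that x] xd e by blast
  qed
  have "c \<noteq> a" "c \<noteq> b"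
    using proper[OF ar p(1) v p(2)] proper[OF ar q(1) v q(2)] V[OF v] by auto
  then have ec: "e \<noteq> c" and ed: "e \<noteq> d" using e ab by auto
  have kdec: "{1..k} = {e, c, d}" using kabc e by auto
  have "e \<in> legal_colours G k h1 v"
    using kdec v V1[OF v] U1 arcs disjoint ec ed by (auto simp: legal_colours_def)
  define h2 where "h2 = (v, e) # h1"
  have ar2: "arises G k \<sigma> h2" and even2: "even (length h2)"
    using bob_move[OF ar1 odd1 avail1[OF _ vx]] \<open>e \<in> _\<close> odd1 v verts by (simp_all add: h2_def)
  have ve: "map_of h2 v = Some e" by (simp add: h2_def)
  have V2: "map_of h2 w = Some c" if "w \<in> V" "w \<noteq> v" for w
    using that V1 by (simp add: h2_def)
  have U2: "map_of h2 u = Some d" if "u \<in> U" for u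
    using that U1 v disjoint by (auto simp: h2_def)
  obtain z f where m3: "\<sigma> h2 = (z, f)" by fastforce
  define h3 where "h3 = (z, f) # h2"
  have ar3: "arises G k \<sigma> h3" and odd3: "odd (length h3)"
    using alice_move[OF ar2 even2] even2 by (simp_all add: h3_def m3)
  note move3 = arises_ConsD(2,3)[OF ar3[unfolded h3_def], simplified]
  \<comment> \<open>Here \<open>n\<close> being at least 3 matters: some \<open>w\<close> in
    \<open>V\<close> differs from Bob's \<open>v\<close> and Alice's \<open>z\<close>, so it still
    has colour \<open>c\<close>.\<close>
  have "card {v, z} < card V" using card_V n by (simp add: card_insert_if)
  then obtain w where w: "w \<in> V" "w \<noteq> v" "w \<noteq> z"
    by (metis card_mono finite.emptyI finite.insertI insert_iff not_le subsetI)
  have "card {x} < card U" using card_U n by simp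
  then obtain y where y: "y \<in> U" "y \<noteq> x"
    by (metis card_mono finite.emptyI finite.insertI insert_iff not_le subsetI)
  \<comment> \<open>A vertex of \<open>U\<close> has colour \<open>d\<close> and sees
    \<open>e\<close> at \<open>v\<close> and \<open>c\<close> at \<open>w\<close>.\<close>
  have "z \<notin> U"
    using swapped.stuck[OF equalityD1[OF kdec] _ v w(1) ve V2[OF w(1,2)] U2] move3(2) by blast
  \<comment> \<open>Bob has used up \<open>v\<close> for this round, while \<open>y\<close> is still
    waiting; so Alice cannot remove \<open>e\<close> from \<open>v\<close>.\<close>
  have "times_chosen h2 y = 1"
    using y v disjoint once verts by (auto simp: h2_def h1_def)
  moreover have "times_chosen h2 v = 2"
    using v vx once verts by (auto simp: h2_def h1_def)
  ultimately have "z \<noteq> v"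
    using move3(1) y(1) verts by (force simp: available_def)
  have "available G h3 y"
    using y v \<open>z \<notin> U\<close> disjoint once verts by (auto simp: available_def h3_def h2_def h1_def)
  moreover have "legal_colours G k h3 y = {}"
    using \<open>z \<noteq> v\<close> \<open>z \<notin> U\<close> ve V2 U2 w y
    by (intro swapped.stuck[OF equalityD1[OF kdec] y(1) v w(1)]) (auto simp: h3_def)
  ultimately show False using bob_not_stuck[OF ar3 odd3] by blast
qed

section \<open>The opening\<close>

lemma opening_lost:
  assumes "fst (\<sigma> []) \<in> U"
  shows False
proof -
  obtain p a where m: "\<sigma> [] = (p, a)" by fastforce
  have p: "p \<in> U" using assms m by simp
  have ar1: "arises G k \<sigma> [(p, a)]" using alice_move[OF arises.start] m by simp
  obtain v where v: "v \<in> V" using card_V n by fastforce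
  have avail1: "available G [(p, a)] u" if "u \<in> verts G" "u \<noteq> p" for u
    using that by (auto simp: available_def)
  have a: "a \<in> {1..k}" using map_of_colour[OF ar1] by fastforce
  have "available G [(p, a)] v" using avail1 v p verts disjoint by blast
  \<comment> \<open>A second colour exists, as otherwise the neighbour \<open>v\<close> of
    \<open>p\<close> would already be stuck.\<close>
  then have "legal_colours G k [(p, a)] v \<noteq> {}" using bob_not_stuck[OF ar1] by simp
  then obtain b where b: "b \<in> {1..k}" "b \<noteq> a"
    using p v arcs by (auto simp: legal_colours_def)
  have "card {p} < card U" using card_U n by simp
  then obtain q where q: "q \<in> U" "q \<noteq> p"
    by (metis card_mono finite.emptyI finite.insertI insert_iff not_le subsetI)
  have "b \<in> legal_colours G k [(p, a)] q"
    using b p q arcs disjoint by (auto simp: legal_colours_def)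
  then have ar2: "arises G k \<sigma> [(q, b), (p, a)]"
    using bob_move[OF ar1] avail1 q verts by simp
  obtain h where h: "arises G k \<sigma> h" "distinct (map fst h)" "fst ` set h \<subseteq> verts G"
    "length h = 2 * n" "map_of [(q, b), (p, a)] \<subseteq>\<^sub>m map_of h"
    using complete_first_round[OF ar2] p q verts n by auto
  have pa: "map_of h p = Some a" and qb: "map_of h q = Some b"
    using h(5) q(2) by (auto simp: map_le_def dom_def split: if_splits)
  have "card (fst ` set h) = 2 * n"
    using h(2,4) distinct_card[of "map fst h"] by simp
  then have set_h: "fst ` set h = verts G"
    using card_subset_eq[OF finite_verts h(3)] card_verts by simp
  have coloured: "\<exists>c. map_of h u = Some c" if "u \<in> verts G" for u
    using that set_h by (metis map_of_eq_None_iff not_None_eq)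
  have once: "times_chosen h u = 1" if "u \<in> verts G" for u
    using that h(2) set_h by (intro times_chosen_distinct) auto
  obtain c where c: "map_of h v = Some c" using coloured v verts by blast
  have cab: "c \<noteq> a" "c \<noteq> b" using proper[OF h(1) _ v] p q pa qb c by auto
  have ck: "c \<in> {1..k}" using map_of_colour[OF h(1) c] .
  \<comment> \<open>Three distinct colours in a palette of at most three fill it.\<close>
  have kabc: "{1..k} = {a, b, c}"
    using card_seteq[of "{1..k}" "{a, b, c}"] a b ck cab k by simp
  have V: "map_of h w = Some c" if w: "w \<in> V" for w
  proof -
    obtain c' where c': "map_of h w = Some c'" using coloured w verts by blast
    then have "c' \<noteq> a" "c' \<noteq> b"
      using proper[OF h(1) p w pa] proper[OF h(1) q(1) w qb] by auto
    then show ?thesis using map_of_colour[OF h(1) c'] c' unfolding kabc by auto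
  qed
  \<comment> \<open>One vertex \<open>v\<close> of colour \<open>c\<close> keeps \<open>c\<close>
    out of all of \<open>U\<close>.\<close>
  have U: "map_of h u = Some a \<or> map_of h u = Some b" if u: "u \<in> U" for u
  proof -
    obtain c' where c': "map_of h u = Some c'" using coloured u verts by blast
    then have "c' \<noteq> c" using proper[OF h(1) u v] c by auto
    then show ?thesis using map_of_colour[OF h(1) c'] c' unfolding kabc by auto
  qed
  show False
    using second_round_lost[OF h(1) _ once kabc b(2)[symmetric] p pa q(1) qb V U] h(4) by simp
qed

lemma contradiction: False
proof -
  have "available G [] (fst (\<sigma> []))"
    using arises_ConsD(2) alice_move[OF arises.start] by simp
  then consider "fst (\<sigma> []) \<in> U" | "fst (\<sigma> []) \<in> V"
    by (auto simp: available_def verts)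
  then show False
    using opening_lost bipartite_win.opening_lost[OF swap] by cases
qed

end

theorem proposition3p6:
  fixes G :: "('a, 'b) pre_digraph" and n :: nat
  assumes "n \<ge> 3" and "complete_bipartite_digraph n n G"
  shows "eternal_game_chromatic_number G \<ge> 4"
proof -
  obtain U V where G: "graph G" "verts G = U \<union> V" "U \<inter> V = {}" "card U = n" "card V = n"
    "arcs_ends G = U \<times> V \<union> V \<times> U"
    using assms(2) unfolding complete_bipartite_digraph_def by blast
  interpret graph G by (rule G(1))
  have "verts G \<noteq> {}" using G assms(1) by auto
  then have "\<exists>k \<sigma>. winning_strategy G k \<sigma>"
    using winning_strategy_exists wf_digraph finite_verts by blast
  \<comment> \<open>The least number is itself a winning one; if it were at most 3, it would satisfy
    the refuted locale.\<close>
  then have "\<exists>\<sigma>. winning_strategy G (eternal_game_chromatic_number G) \<sigma>"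
    unfolding eternal_game_chromatic_number_def by (rule LeastI_ex)
  then obtain \<sigma> where "winning_strategy G (eternal_game_chromatic_number G) \<sigma>" ..
  then have "\<not> eternal_game_chromatic_number G \<le> 3"
    using bipartite_win.contradiction[of G _ n \<sigma> U V] assms(1) G by (auto simp: bipartite_win_def)
  then show ?thesis by simp
qed

end
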